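(* Let $f$ be a topologically mixing continuous map on a totally bounded metric space $X$. Then every shadowable point of $f$ is a specification point of $f$.
   Context: Let $f$ be a continuous map on a metric space $(X,d)$. $f$ is topologically mixing if for every pair of non-empty open sets $U,V$ there is $N\in\mathbb{N}$ such that $f^n(U)\cap V\ne\emptyset$ for all $n\ge N$. For $\delta>0$, a sequence $(x_i)_{i\ge0}$ in $X$ is a $\delta$-pseudo orbit for $f$ if $d(f(x_i),x_{i+1})<\delta$ for all $i\ge0$. It is through a subset $B\subset X$ if $x_0\in B$ (through a point $x$ if $x_0=x$). A sequence $(x_i)_{i\ge0}$ is $\epsilon$-traced if there is $z\in X$ with $d(f^i(z),x_i)<\epsilon$ for all $i\ge0$. A point $x\in X$ is a shadowable point of $f$ if for every $\epsilon>0$ there is $\delta>0$ such that every $\delta$-pseudo orbit through $x$ can be $\epsilon$-traced. A point $x\in X$ is a specification point of $f$ if for every $\epsilon>0$ there is a positive integer $M(\epsilon)$ such that for any finite sequence $x=x_1,x_2,\dots,x_k$ in $X$ (whose first term is $x$) and any integers $0\le a_1\le b_1<a_2\le b_2<\dots<a_k\le b_k$ with $a_j-b_{j-1}\ge M(\epsilon)$ for all $2\le j\le k$, there is $y\in X$ with $d(f^i(y),f^i(x_j))<\epsilon$ for all $a_j\le i\le b_j$ and all $1\le j\le k$. *)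

theory Defs
  imports Complex_Main
begin

definition topologically_mixing :: "('a::topological_space \<Rightarrow> 'a) \<Rightarrow> bool" where
  "topologically_mixing f \<longleftrightarrow>
     (\<forall>U V. open U \<longrightarrow> U \<noteq> {} \<longrightarrow> open V \<longrightarrow> V \<noteq> {} \<longrightarrow>
        (\<exists>N::nat. \<forall>n\<ge>N. (f ^^ n) ` U \<inter> V \<noteq> {}))"

definition pseudo_orbit :: "real \<Rightarrow> ('a::metric_space \<Rightarrow> 'a) \<Rightarrow> (nat \<Rightarrow> 'a) \<Rightarrow> bool" where
  "pseudo_orbit \<delta> f \<xi> \<longleftrightarrow> (\<forall>i. dist (f (\<xi> i)) (\<xi> (Suc i)) < \<delta>)"

definition traced :: "real \<Rightarrow> ('a::metric_space \<Rightarrow> 'a) \<Rightarrow> (nat \<Rightarrow> 'a) \<Rightarrow> bool" where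
  "traced \<epsilon> f \<xi> \<longleftrightarrow> (\<exists>z. \<forall>i. dist ((f ^^ i) z) (\<xi> i) < \<epsilon>)"

definition shadowable_point :: "('a::metric_space \<Rightarrow> 'a) \<Rightarrow> 'a \<Rightarrow> bool" where
  "shadowable_point f x \<longleftrightarrow>
     (\<forall>\<epsilon>>0. \<exists>\<delta>>0. \<forall>\<xi>. pseudo_orbit \<delta> f \<xi> \<longrightarrow> \<xi> 0 = x \<longrightarrow> traced \<epsilon> f \<xi>)"

text \<open>The finite sequences \<open>x\<^sub>1, \<dots>, x\<^sub>k\<close>, \<open>a\<^sub>1, \<dots>, a\<^sub>k\<close>
  and \<open>b\<^sub>1, \<dots>, b\<^sub>k\<close> are the restrictions to \<open>{1..k}\<close> of functions
  on \<open>nat\<close>; values outside \<open>{1..k}\<close> are irrelevant. The gap condition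
  \<open>a\<^sub>j - b\<^sub>j\<^sub>-\<^sub>1 \<ge> M\<close> is written without truncated subtraction.\<close>

definition specification_point :: "('a::metric_space \<Rightarrow> 'a) \<Rightarrow> 'a \<Rightarrow> bool" where
  "specification_point f x \<longleftrightarrow>
     (\<forall>\<epsilon>>0. \<exists>M::nat. M > 0 \<and>
        (\<forall>(k::nat) (xs::nat \<Rightarrow> 'a) (a::nat \<Rightarrow> nat) (b::nat \<Rightarrow> nat).
           k \<ge> 1 \<longrightarrow> xs 1 = x \<longrightarrow>
           (\<forall>j\<in>{1..k}. a j \<le> b j) \<longrightarrow>
           (\<forall>j\<in>{2..k}. b (j - 1) < a j) \<longrightarrow>
           (\<forall>j\<in>{2..k}. a j \<ge> b (j - 1) + M) \<longrightarrow>
           (\<exists>y. \<forall>j\<in>{1..k}. \<forall>i\<in>{a j..b j}. dist ((f ^^ i) y) ((f ^^ i) (xs j)) < \<epsilon>)))"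

end

theory Submission imports Defs begin

text \<open>
  A specification problem \<open>x\<^sub>1, \<dots>, x\<^sub>k\<close> with widely spaced time windows is a request to jump
  from one orbit to another during each gap. Mixing together with total boundedness gives a
  single time \<open>M\<close> such that for all points \<open>u, v\<close> and all \<open>n \<ge> M\<close> some orbit segment of
  length \<open>n\<close> begins \<open>\<delta>\<close>-close to \<open>u\<close> and ends \<open>\<delta>\<close>-close to \<open>v\<close>
  (\<open>mixing_uniform_transition\<close>). Putting such a segment in every gap joins the prescribed
  orbit segments to a \<open>\<delta>\<close>-pseudo orbit that agrees with \<open>f\<^sup>i(x\<^sub>j)\<close> exactly on the \<open>j\<close>-th
  window (\<open>pseudo_orbit_through_windows\<close>). It follows the orbit of \<open>x\<^sub>1\<close> from time \<open>0\<close> on, even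
  when the first window opens later, so it is a pseudo orbit through \<open>x\<^sub>1\<close>: shadowability at
  this one point yields a tracing point, and that point solves the specification problem.
\<close>

text \<open>
  Mixing supplies a waiting time for each pair of open sets. Balls around the points of a finite
  \<open>\<delta>/2\<close>-net give finitely many pairs, so one time serves all of them, and the triangle
  inequality passes from the centres to arbitrary points.
\<close>

lemma mixing_uniform_transition:
  fixes f :: "'a::metric_space \<Rightarrow> 'a"
  assumes tb: "totally_bounded (UNIV :: 'a set)" and mix: "topologically_mixing f"
    and "\<delta> > 0"
  obtains M where "\<And>n u v. n \<ge> M \<Longrightarrow> \<exists>z. dist u z < \<delta> \<and> dist ((f ^^ n) z) v < \<delta>"
proof -
  have "eventually (\<lambda>(x, y). dist x y < \<delta> / 2) (uniformity :: ('a \<times> 'a) filter)"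
    using \<open>\<delta> > 0\<close> unfolding eventually_uniformity_metric by (intro exI[of _ "\<delta> / 2"]) auto
  then obtain P :: "'a set" where "finite P" and net: "\<And>s. \<exists>p\<in>P. dist p s < \<delta> / 2"
    using tb unfolding totally_bounded_def by (metis (mono_tags, lifting) UNIV_I case_prodD)
  have ball: "open {y. dist c y < \<delta> / 2}" "{y. dist c y < \<delta> / 2} \<noteq> {}" for c :: 'a
  proof -
    show "open {y. dist c y < \<delta> / 2}"
      by (intro open_Collect_less continuous_intros)
    have "c \<in> {y. dist c y < \<delta> / 2}" using \<open>\<delta> > 0\<close> by simp
    then show "{y. dist c y < \<delta> / 2} \<noteq> {}" by blast
  qed
  have "\<exists>N. \<forall>n\<ge>N. (f ^^ n) ` {y. dist p y < \<delta> / 2} \<inter> {y. dist q y < \<delta> / 2} \<noteq> {}" for p q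
    using mix ball[of p] ball[of q] unfolding topologically_mixing_def by blast
  then obtain N where N: "\<And>p q n. n \<ge> N p q \<Longrightarrow>
      (f ^^ n) ` {y. dist p y < \<delta> / 2} \<inter> {y. dist q y < \<delta> / 2} \<noteq> {}"
    by metis
  define M where "M = Max ((\<lambda>(p, q). N p q) ` (P \<times> P))"
  have M: "N p q \<le> M" if "p \<in> P" "q \<in> P" for p q
    unfolding M_def using that \<open>finite P\<close> by (intro Max_ge) auto
  show thesis
  proof (rule that)
    fix n u v assume "n \<ge> M"
    obtain p q where pq: "p \<in> P" "dist p u < \<delta> / 2" "q \<in> P" "dist q v < \<delta> / 2"
      using net by meson
    have "n \<ge> N p q" using M pq \<open>n \<ge> M\<close> le_trans by blast
    then obtain z where "dist p z < \<delta> / 2" "dist q ((f ^^ n) z) < \<delta> / 2"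
      using N by blast
    with pq show "\<exists>z. dist u z < \<delta> \<and> dist ((f ^^ n) z) v < \<delta>"
      by (metis dist_commute dist_triangle_half_l)
  qed
qed

text \<open>
  Induction on the number of windows. Since the pseudo orbit built for \<open>k\<close> windows continues
  forever along the true orbit of \<open>x\<^sub>k\<close>, it can be cut at time \<open>b\<^sub>k\<close> and redirected: a
  connecting segment starts at time \<open>b\<^sub>k + 1\<close> and has \<open>a\<^sub>k\<^sub>+\<^sub>1 - b\<^sub>k - 1\<close> steps before the
  orbit of \<open>x\<^sub>k\<^sub>+\<^sub>1\<close> takes over. This is why the gaps must exceed the transition time \<open>M\<close>
  strictly; \<open>M > 0\<close> makes the segment nonempty, so that its two ends cause errors at two
  different times and each stays below \<open>\<delta>\<close>.
\<close>

lemma pseudo_orbit_through_windows: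
  fixes f :: "'a::metric_space \<Rightarrow> 'a" and xs :: "nat \<Rightarrow> 'a" and a b :: "nat \<Rightarrow> nat"
  assumes trans: "\<And>n u v. n \<ge> M \<Longrightarrow> \<exists>z. dist u z < \<delta> \<and> dist ((f ^^ n) z) v < \<delta>"
    and "M > 0" and "\<delta> > 0"
    and "k \<ge> 1"
    and "\<forall>j\<in>{1..k}. a j \<le> b j"
    and "\<forall>j\<in>{2..k}. b (j - 1) + M < a j"
  shows "\<exists>\<xi>. pseudo_orbit \<delta> f \<xi> \<and> \<xi> 0 = xs 1 \<and>
           (\<forall>j\<in>{1..k}. b j \<le> b k \<and> (\<forall>i\<in>{a j..b j}. \<xi> i = (f ^^ i) (xs j))) \<and>
           (\<forall>i\<ge>b k. \<xi> i = (f ^^ i) (xs k))"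
  using assms(4-6)
proof (induction k rule: dec_induct)
  case base
  then show ?case
    using \<open>\<delta> > 0\<close> by (intro exI[of _ "\<lambda>i. (f ^^ i) (xs 1)"]) (auto simp: pseudo_orbit_def)
next
  case (step k)
  then obtain \<xi> where po: "pseudo_orbit \<delta> f \<xi>" and "\<xi> 0 = xs 1"
    and win: "\<And>j. j \<in> {1..k} \<Longrightarrow> b j \<le> b k"
             "\<And>j i. j \<in> {1..k} \<Longrightarrow> i \<in> {a j..b j} \<Longrightarrow> \<xi> i = (f ^^ i) (xs j)"
    and tail: "\<xi> (b k) = (f ^^ b k) (xs k)"
    by auto
  have ab: "a (Suc k) \<le> b (Suc k)"
    using step.prems(1) by auto
  have gap: "b k + M < a (Suc k)"
    using bspec[OF step.prems(2), of "Suc k"] step.hyps(1) by simp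
  define n where "n = a (Suc k) - Suc (b k)"
  have "n \<ge> M" "n > 0" and a_eq: "a (Suc k) = Suc (b k) + n"
    using gap \<open>M > 0\<close> by (auto simp: n_def)
  obtain z where z: "dist ((f ^^ Suc (b k)) (xs k)) z < \<delta>"
      "dist ((f ^^ n) z) ((f ^^ a (Suc k)) (xs (Suc k))) < \<delta>"
    using trans[OF \<open>n \<ge> M\<close>] by blast
  define \<eta> where "\<eta> i = (if i \<le> b k then \<xi> i
      else if i < a (Suc k) then (f ^^ (i - Suc (b k))) z
      else (f ^^ i) (xs (Suc k)))" for i
  have "dist (f (\<eta> i)) (\<eta> (Suc i)) < \<delta>" for i
  proof -
    consider "i < b k" | "i = b k" | "b k < i" "Suc i < a (Suc k)" | "Suc i = a (Suc k)" "b k < i"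
      | "a (Suc k) \<le> i" "b k < i"
      using gap by linarith
    then show ?thesis
    proof cases
      case 1
      then show ?thesis using po by (simp add: \<eta>_def pseudo_orbit_def)
    next
      case 2
      then show ?thesis using z(1) tail a_eq \<open>n > 0\<close> by (simp add: \<eta>_def)
    next
      case 3
      then have "Suc i - Suc (b k) = Suc (i - Suc (b k))" by simp
      with 3 show ?thesis using \<open>\<delta> > 0\<close> by (simp add: \<eta>_def del: diff_Suc_Suc)
    next
      case 4
      then have "n = Suc (i - Suc (b k))" by (simp add: n_def)
      then have "f (\<eta> i) = (f ^^ n) z" using 4 by (simp add: \<eta>_def)
      moreover have "\<eta> (Suc i) = (f ^^ a (Suc k)) (xs (Suc k))" using 4 by (simp add: \<eta>_def)
      ultimately show ?thesis using z(2) by simp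
    next
      case 5
      then show ?thesis using \<open>\<delta> > 0\<close> by (simp add: \<eta>_def)
    qed
  qed
  then have "pseudo_orbit \<delta> f \<eta>"
    by (simp add: pseudo_orbit_def)
  moreover have "\<eta> 0 = xs 1"
    using \<open>\<xi> 0 = xs 1\<close> by (simp add: \<eta>_def)
  moreover have late: "\<eta> i = (f ^^ i) (xs (Suc k))" if "i \<ge> a (Suc k)" for i
    using that gap by (simp add: \<eta>_def)
  moreover have "b j \<le> b (Suc k) \<and> (\<forall>i\<in>{a j..b j}. \<eta> i = (f ^^ i) (xs j))"
    if "j \<in> {1..Suc k}" for j
  proof (cases "j = Suc k")
    case True
    then show ?thesis using late by simp
  next
    case False
    then have j: "j \<in> {1..k}" using that by auto
    have "\<eta> i = (f ^^ i) (xs j)" if "i \<in> {a j..b j}" for i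
      using win(1)[OF j] win(2)[OF j that] that by (simp add: \<eta>_def)
    then show ?thesis using win(1)[OF j] gap ab by auto
  qed
  ultimately show ?case
    using ab by (intro exI[of _ \<eta>]) auto
qed

theorem theorem4p11:
  fixes f :: "'a::metric_space \<Rightarrow> 'a"
  assumes "totally_bounded (UNIV :: 'a set)"
    and "continuous_on UNIV f"
    and "topologically_mixing f"
  shows "\<forall>x. shadowable_point f x \<longrightarrow> specification_point f x"
proof (intro allI impI)
  fix x assume shad: "shadowable_point f x"
  show "specification_point f x"
    unfolding specification_point_def
  proof (intro allI impI)
    fix \<epsilon> :: real assume "\<epsilon> > 0"
    then obtain \<delta> where "\<delta> > 0"
      and \<delta>: "\<And>\<xi>. pseudo_orbit \<delta> f \<xi> \<Longrightarrow> \<xi> 0 = x \<Longrightarrow> traced \<epsilon> f \<xi>"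
      using shad unfolding shadowable_point_def by blast
    obtain M where M: "\<And>n u v. n \<ge> M \<Longrightarrow> \<exists>z. dist u z < \<delta> \<and> dist ((f ^^ n) z) v < \<delta>"
      using mixing_uniform_transition[OF assms(1,3) \<open>\<delta> > 0\<close>] by blast
    (* One unit makes the transition time positive, the other makes the gaps exceed it. *)
    show "\<exists>M::nat. M > 0 \<and> (\<forall>(k::nat) (xs::nat \<Rightarrow> 'a) (a::nat \<Rightarrow> nat) (b::nat \<Rightarrow> nat). k \<ge> 1 \<longrightarrow> xs 1 = x \<longrightarrow>
           (\<forall>j\<in>{1..k}. a j \<le> b j) \<longrightarrow>
           (\<forall>j\<in>{2..k}. b (j - 1) < a j) \<longrightarrow>
           (\<forall>j\<in>{2..k}. a j \<ge> b (j - 1) + M) \<longrightarrow>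
           (\<exists>y. \<forall>j\<in>{1..k}. \<forall>i\<in>{a j..b j}. dist ((f ^^ i) y) ((f ^^ i) (xs j)) < \<epsilon>))"
    proof (intro exI[of _ "M + 2"] conjI allI impI)
      fix k :: nat and xs :: "nat \<Rightarrow> 'a" and a b :: "nat \<Rightarrow> nat"
      assume *: "k \<ge> 1" "xs 1 = x" "\<forall>j\<in>{1..k}. a j \<le> b j"
        "\<forall>j\<in>{2..k}. a j \<ge> b (j - 1) + (M + 2)"
      have gaps: "\<forall>j\<in>{2..k}. b (j - 1) + (M + 1) < a j"
        using *(4) by (auto simp: Suc_le_eq)
      have "\<exists>\<xi>. pseudo_orbit \<delta> f \<xi> \<and> \<xi> 0 = xs 1 \<and>
           (\<forall>j\<in>{1..k}. b j \<le> b k \<and> (\<forall>i\<in>{a j..b j}. \<xi> i = (f ^^ i) (xs j))) \<and>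
           (\<forall>i\<ge>b k. \<xi> i = (f ^^ i) (xs k))"
      proof (rule pseudo_orbit_through_windows)
        show "\<exists>z. dist u z < \<delta> \<and> dist ((f ^^ n) z) v < \<delta>" if "n \<ge> M + 1" for n u v
          using M that by simp
      qed (use \<open>\<delta> > 0\<close> *(1,3) gaps in simp_all)
      then obtain \<xi> where \<xi>: "pseudo_orbit \<delta> f \<xi>" "\<xi> 0 = x"
        "\<forall>j\<in>{1..k}. \<forall>i\<in>{a j..b j}. \<xi> i = (f ^^ i) (xs j)"
        using *(2) by auto
      then obtain y where "\<And>i. dist ((f ^^ i) y) (\<xi> i) < \<epsilon>"
        using \<delta> unfolding traced_def by blast
      with \<xi>(3) show "\<exists>y. \<forall>j\<in>{1..k}. \<forall>i\<in>{a j..b j}. dist ((f ^^ i) y) ((f ^^ i) (xs j)) < \<epsilon>"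
        by metis
    qed simp
  qed
qed

end
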